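(* For all positive integers $n,k,\ell$ with $k\ge \ell$, we have $b_{n,k,\ell}\le \frac{k n^{k-1}}{\ell}$. Furthermore, if $k\ge \ell\ge 2$, then \[ c_{n,k,\ell}\le \frac{\binom{k}{2} n^{k-2}}{\binom{\ell}{2}}. \]
   Context: Let $H_{n,k}=\{0,1,\dots,n-1\}^k$. For $\ell\le k$, an $\ell$-rook is a point $P\in H_{n,k}$ together with a set $D$ of $\ell$ of the $k$ coordinate indices; it covers (attacks) $P$ itself and every point of $H_{n,k}$ which differs from $P$ in exactly one coordinate, that coordinate belonging to $D$. Distinct rooks must occupy distinct points. $b_{n,k,\ell}$ is the maximum number of $\ell$-rooks that can be placed in $H_{n,k}$ so that no rook attacks the position of another rook. $c_{n,k,\ell}$ is the maximum number of $\ell$-rooks that can be placed in $H_{n,k}$ so that no point of $H_{n,k}$ is covered by two different rooks. *)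

theory Defs
  imports Complex_Main "HOL-Library.FuncSet"
begin

definition hypercube :: "nat \<Rightarrow> nat \<Rightarrow> (nat \<Rightarrow> nat) set" where
  "hypercube n k = {..<k} \<rightarrow>\<^sub>E {..<n}"

text \<open>A rook is a pair of its position and the set of its attack directions; the coordinates
  are indexed by \<open>0, \<dots>, k - 1\<close>.\<close>

type_synonym rook = "(nat \<Rightarrow> nat) \<times> nat set"

definition rooks :: "nat \<Rightarrow> nat \<Rightarrow> nat \<Rightarrow> rook set" where
  "rooks n k l = hypercube n k \<times> {D. D \<subseteq> {..<k} \<and> card D = l}"

definition covered :: "nat \<Rightarrow> nat \<Rightarrow> rook \<Rightarrow> (nat \<Rightarrow> nat) set" where
  "covered n k r =
    {Q \<in> hypercube n k. Q = fst r \<or> (\<exists>i \<in> snd r. {j. j < k \<and> Q j \<noteq> fst r j} = {i})}"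

text \<open>Distinct rooks occupy distinct points, so no rook is repeated and a placement is a set.\<close>

definition placement :: "nat \<Rightarrow> nat \<Rightarrow> nat \<Rightarrow> rook set \<Rightarrow> bool" where
  "placement n k l S \<longleftrightarrow> S \<subseteq> rooks n k l \<and> inj_on fst S"

definition nonattacking :: "nat \<Rightarrow> nat \<Rightarrow> rook set \<Rightarrow> bool" where
  "nonattacking n k S \<longleftrightarrow> (\<forall>r \<in> S. \<forall>s \<in> S. r \<noteq> s \<longrightarrow> fst s \<notin> covered n k r)"

definition nonoverlapping :: "nat \<Rightarrow> nat \<Rightarrow> rook set \<Rightarrow> bool" where
  "nonoverlapping n k S \<longleftrightarrow>
    (\<forall>r \<in> S. \<forall>s \<in> S. r \<noteq> s \<longrightarrow> covered n k r \<inter> covered n k s = {})"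

definition rook_b :: "nat \<Rightarrow> nat \<Rightarrow> nat \<Rightarrow> nat" where
  "rook_b n k l = Max (card ` {S. placement n k l S \<and> nonattacking n k S})"

definition rook_c :: "nat \<Rightarrow> nat \<Rightarrow> nat \<Rightarrow> nat" where
  "rook_c n k l = Max (card ` {S. placement n k l S \<and> nonoverlapping n k S})"

text \<open>Both maxima range over finite nonempty sets, as there are finitely many placements and the
  empty one is always admissible.\<close>

lemma finite_placements: "finite {S. placement n k l S}"
proof -
  have "finite (rooks n k l)"
    unfolding rooks_def hypercube_def by (intro finite_cartesian_product finite_PiE) auto
  then show ?thesis
    by (rule finite_subset[rotated, OF finite_Pow_iff[THEN iffD2]]) (auto simp: placement_def)
qed

lemma empty_placement: "placement n k l {}" "nonattacking n k {}" "nonoverlapping n k {}"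
  by (auto simp: placement_def nonattacking_def nonoverlapping_def)

end

theory Submission
  imports Defs
begin

text \<open>Both bounds are one double count. A rook with direction set \<open>D\<close> spans, for each
  \<open>m\<close>-subset \<open>E\<close> of \<open>D\<close>, the axis-parallel \<open>m\<close>-dimensional subspace through its position with
  free coordinates \<open>E\<close>, and there are \<open>(k choose m) * n ^ (k - m)\<close> such subspaces in all.
  No subspace is spanned twice: for \<open>m = 1\<close>, two rooks spanning the same line attack each
  other; for \<open>m = 2\<close>, two rooks spanning the same plane both cover a corner of the rectangle
  in which their positions are opposite corners.\<close>

text \<open>\<open>Q\<close> need not differ from \<open>P\<close> in coordinate \<open>i\<close>:
  if it does not, \<open>Q\<close> is \<open>P\<close> itself, which a rook also covers. Uses of
  this rule thus need no case split on whether two positions share a coordinate.\<close>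

lemma mem_coveredI:
  assumes "P \<in> hypercube n k" "Q \<in> hypercube n k" "i \<in> D"
    and agree: "\<And>j. j < k \<Longrightarrow> j \<noteq> i \<Longrightarrow> Q j = P j"
  shows "Q \<in> covered n k (P, D)"
proof (cases "i < k \<and> Q i \<noteq> P i")
  case True
  then have "{j. j < k \<and> Q j \<noteq> P j} = {i}"
    using agree by blast
  then show ?thesis
    using assms(2,3) by (auto simp: covered_def)
next
  case False
  then have "Q = P"
    using assms(1,2) agree unfolding hypercube_def by (intro PiE_ext) auto
  then show ?thesis
    using assms(2) by (simp add: covered_def)
qed

text \<open>Incidences of rooks with the subspaces they span map injectively into the set of all
  subspaces. \<open>uniq\<close> excludes a subspace shared by two rooks; different \<open>E\<close>
  for one rook give different subspaces anyway.\<close>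

lemma card_rooks_le_subspaces:
  assumes S: "S \<subseteq> rooks n k l"
    and uniq: "\<And>P D P' D' E. \<lbrakk>(P, D) \<in> S; (P', D') \<in> S; E \<subseteq> D; E \<subseteq> D'; card E = m;
      \<And>j. j < k \<Longrightarrow> j \<notin> E \<Longrightarrow> P j = P' j\<rbrakk> \<Longrightarrow> (P, D) = (P', D')"
  shows "card S * (l choose m) \<le> (k choose m) * n ^ (k - m)"
proof -
  define A where "A = (SIGMA r:S. {E. E \<subseteq> snd r \<and> card E = m})"
  \<comment> \<open>A subspace is encoded by its free coordinates \<open>E\<close> and the values at
    which the remaining \<open>k - m\<close> coordinates are fixed; \<open>f\<close> sends an
    incidence to this code.\<close>
  define B where
    "B = (SIGMA E:{E. E \<subseteq> {..<k} \<and> card E = m}. ({..<k} - E) \<rightarrow>\<^sub>E {..<n})"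
  define f where "f = (\<lambda>(r :: rook, E). (E, restrict (fst r) ({..<k} - E)))"
  have "finite (rooks n k l)"
    unfolding rooks_def hypercube_def by (intro finite_cartesian_product finite_PiE) auto
  then have "finite S"
    using S finite_subset by blast
  have D: "finite (snd r)" "snd r \<subseteq> {..<k}" "card (snd r) = l" if "r \<in> S" for r
  proof -
    show "snd r \<subseteq> {..<k}" "card (snd r) = l"
      using subsetD[OF S that] by (auto simp: rooks_def)
    then show "finite (snd r)"
      using finite_subset by blast
  qed
  have "card A = (\<Sum>r\<in>S. card {E. E \<subseteq> snd r \<and> card E = m})"
    unfolding A_def using \<open>finite S\<close> D(1) by (intro card_SigmaI) auto
  also have "\<dots> = card S * (l choose m)"
    using D by (simp add: n_subsets)
  finally have card_A: "card A = card S * (l choose m)" .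
  have "card B = (\<Sum>E\<in>{E. E \<subseteq> {..<k} \<and> card E = m}. card (({..<k} - E) \<rightarrow>\<^sub>E {..<n}))"
    unfolding B_def by (intro card_SigmaI) (auto intro: finite_PiE)
  also have "\<dots> = (\<Sum>E\<in>{E. E \<subseteq> {..<k} \<and> card E = m}. n ^ (k - m))"
    by (intro sum.cong) (auto simp: card_PiE card_Diff_subset finite_subset)
  also have "\<dots> = (k choose m) * n ^ (k - m)"
    by (simp add: n_subsets)
  finally have card_B: "card B = (k choose m) * n ^ (k - m)" .
  have "inj_on f A"
  proof (rule inj_onI)
    fix x y assume x: "x \<in> A" and y: "y \<in> A" and eq: "f x = f y"
    obtain P D E P' D' E' where xy: "x = ((P, D), E)" "y = ((P', D'), E')"
      by (metis surj_pair)
    have "E' = E" and res: "restrict P ({..<k} - E) = restrict P' ({..<k} - E)"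
      using eq by (auto simp: f_def xy)
    have "P j = P' j" if "j < k" "j \<notin> E" for j
      using fun_cong[OF res, of j] that by simp
    then have "(P, D) = (P', D')"
      using x y \<open>E' = E\<close> by (intro uniq[of P D P' D' E]) (auto simp: A_def xy)
    then show "x = y"
      using \<open>E' = E\<close> by (simp add: xy)
  qed
  moreover have "f ` A \<subseteq> B"
    using S D(2) by (fastforce simp: A_def B_def f_def rooks_def hypercube_def)
  moreover have "finite B"
    unfolding B_def by (intro finite_SigmaI) (auto intro: finite_PiE)
  ultimately show ?thesis
    using card_inj_on_le card_A card_B by metis
qed

lemma card_nonattacking_le:
  assumes "placement n k l S" "nonattacking n k S"
  shows "card S * l \<le> k * n ^ (k - 1)"
proof -
  have S: "S \<subseteq> rooks n k l"
    using assms(1) by (simp add: placement_def)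
  have "card S * (l choose 1) \<le> (k choose 1) * n ^ (k - 1)"
  proof (rule card_rooks_le_subspaces[OF S])
    fix P D P' D' and E :: "nat set"
    assume r: "(P, D) \<in> S" "(P', D') \<in> S" and E: "E \<subseteq> D" "card E = 1"
      and agree: "\<And>j. j < k \<Longrightarrow> j \<notin> E \<Longrightarrow> P j = P' j"
    obtain i where i: "E = {i}"
      using E(2) card_1_singletonE by blast
    \<comment> \<open>The positions agree off \<open>i\<close>, so \<open>P'\<close> lies on the
      line through \<open>P\<close> in direction \<open>i\<close>, an attack direction of the first
      rook.\<close>
    have "P' \<in> covered n k (P, D)"
      using S r E i agree by (intro mem_coveredI[of _ _ _ _ i]) (auto simp: rooks_def)
    then show "(P, D) = (P', D')"
      using assms(2) r unfolding nonattacking_def by (metis fst_conv)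
  qed
  then show ?thesis
    by simp
qed

lemma card_nonoverlapping_le:
  assumes "placement n k l S" "nonoverlapping n k S"
  shows "card S * (l choose 2) \<le> (k choose 2) * n ^ (k - 2)"
proof -
  have S: "S \<subseteq> rooks n k l"
    using assms(1) by (simp add: placement_def)
  show ?thesis
  proof (rule card_rooks_le_subspaces[OF S])
    fix P D P' D' and E :: "nat set"
    assume r: "(P, D) \<in> S" "(P', D') \<in> S" and E: "E \<subseteq> D" "E \<subseteq> D'" "card E = 2"
      and agree: "\<And>j. j < k \<Longrightarrow> j \<notin> E \<Longrightarrow> P j = P' j"
    obtain i j where ij: "E = {i, j}" "i \<noteq> j"
      using E(3) card_2_iff by metis
    \<comment> \<open>This corner differs from \<open>P\<close> at most in \<open>i\<close> and from
      \<open>P'\<close> at most in \<open>j\<close>. If the rectangle degenerates, it coincides with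
      \<open>P\<close> or \<open>P'\<close> and is still covered by both rooks.\<close>
    define Q where "Q = P(i := P' i)"
    have cube: "P \<in> hypercube n k" "P' \<in> hypercube n k" and "i < k"
      using S r E(1) ij by (auto simp: rooks_def)
    then have Q: "Q \<in> hypercube n k"
      by (auto simp: Q_def hypercube_def PiE_iff extensional_def)
    have "Q \<in> covered n k (P, D)"
      using cube Q E ij by (intro mem_coveredI[of _ _ _ _ i]) (auto simp: Q_def)
    moreover have "Q \<in> covered n k (P', D')"
      using cube Q E ij agree by (intro mem_coveredI[of _ _ _ _ j]) (auto simp: Q_def)
    ultimately show "(P, D) = (P', D')"
      using assms(2) r unfolding nonoverlapping_def by blast
  qed
qed

text \<open>An extremal placement transfers a bound on all admissible placements to the
  maximum.\<close>

lemma rook_b_attained: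
  obtains S where "placement n k l S" "nonattacking n k S" "card S = rook_b n k l"
proof -
  have "rook_b n k l \<in> card ` {S. placement n k l S \<and> nonattacking n k S}"
    unfolding rook_b_def
    using finite_placements[of n k l] empty_placement by (intro Max_in) blast+
  then show ?thesis
    using that by auto
qed

lemma rook_c_attained:
  obtains S where "placement n k l S" "nonoverlapping n k S" "card S = rook_c n k l"
proof -
  have "rook_c n k l \<in> card ` {S. placement n k l S \<and> nonoverlapping n k S}"
    unfolding rook_c_def
    using finite_placements[of n k l] empty_placement by (intro Max_in) blast+
  then show ?thesis
    using that by auto
qed

theorem theorem3:
  fixes n k l :: nat
  assumes "n > 0" and "k > 0" and "l > 0" and "k \<ge> l"
  shows "real (rook_b n k l) \<le> real k * real n ^ (k - 1) / real l \<and>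
    (l \<ge> 2 \<longrightarrow> real (rook_c n k l) \<le> real (k choose 2) * real n ^ (k - 2) / real (l choose 2))"
proof (intro conjI impI)
  have "rook_b n k l * l \<le> k * n ^ (k - 1)"
    using rook_b_attained card_nonattacking_le by metis
  then have "real (rook_b n k l) * real l \<le> real k * real n ^ (k - 1)"
    by (metis of_nat_le_iff of_nat_mult of_nat_power)
  then show "real (rook_b n k l) \<le> real k * real n ^ (k - 1) / real l"
    using \<open>l > 0\<close> by (simp add: pos_le_divide_eq)
next
  assume "l \<ge> 2"
  have "rook_c n k l * (l choose 2) \<le> (k choose 2) * n ^ (k - 2)"
    using rook_c_attained card_nonoverlapping_le by metis
  then have "real (rook_c n k l) * real (l choose 2) \<le> real (k choose 2) * real n ^ (k - 2)"
    by (metis of_nat_le_iff of_nat_mult of_nat_power)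
  \<comment> \<open>For \<open>l = 1\<close> the divisor would be 0 and the quotient 0 by
    convention, so \<open>l \<ge> 2\<close> is what permits the division.\<close>
  moreover have "l choose 2 > 0"
    using \<open>l \<ge> 2\<close> by simp
  ultimately show "real (rook_c n k l) \<le> real (k choose 2) * real n ^ (k - 2) / real (l choose 2)"
    by (simp add: pos_le_divide_eq)
qed

end
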